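(* Fix an orthant index $r$ (i.e. a sign matrix $J^{(r)}=\mathrm{diag}(j^{(r)}_{11},\dots,j^{(r)}_{nn})$, $j^{(r)}_{ii}\in\{-1,1\}$) and $\epsilon>0$. Let $\tilde K^{(r)}=[\tilde k_{il}]\in\mathbb R^{n\times n}$ be an optimal solution of the linear program $$\min\ -\sum_{i,l=1}^n\tilde k_{il}$$ subject to $$-\tilde k_{il}\le\frac{a_{il}}{\hat c_{ii}}\quad\forall\, i,l=1,\dots,n,$$ $$\sum_{l=1}^n\tilde k_{il}\le\frac{1}{\hat c_{ii}}\Big(1-\sum_{l=1}^n a_{il}\Big)-\epsilon\quad\forall\, i=1,\dots,n,$$ $$-\sum_{l=1}^n\tilde k_{il}\le\frac{1}{\hat c_{ii}}\sum_{l=1}^n a_{il}\quad\forall\, i=1,\dots,n,$$ $$\tilde k_{ii}=0\quad\forall\, i=1,\dots,n.$$ Then the closed-loop matrix $\tilde A^{(r)}=[\tilde a_{il}]:=A^{(r)}+\hat C\tilde K^{(r)}$ has all entries nonnegative, and it satisfies the sufficient condition for stability $$0\le\sum_{l=1,\,l\ne i}^n\tilde a_{il}<1\quad\text{for all } i=1,\dots,n.$$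
   Context: Setting: $C=[c_{il}]\in\mathbb R^{n\times n}$ with $c_{il}\in[0,1]$, $c_{ii}=0$; $\hat c_{ii}:=1-\sum_{j\ne i}c_{ji}$, assumed $>0$ for every $i$; $\hat C:=\mathrm{diag}(\hat c_{11},\dots,\hat c_{nn})$; $A^{(r)}=[a_{il}]:=J^{(r)}\hat C C\hat C^{-1}J^{(r)}$, so $a_{ii}=0$ and $a_{il}=j^{(r)}_{ii}\hat c_{ii}c_{il}\hat c_{ll}^{-1}j^{(r)}_{ll}$ for $i\ne l$. The matrix $\tilde A^{(r)}$ is the state matrix of the closed-loop system $X(t+1)=\tilde A^{(r)}X(t)+\tilde b^{(r)}$ obtained with the feedback gain $K^{(r)}=J^{(r)}\tilde K^{(r)}$. *)

theory Defs
  imports "HOL-Analysis.Analysis"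
begin

definition diag_matrix :: "real ^ 'n \<Rightarrow> real ^ 'n ^ 'n" where
  "diag_matrix d = (\<chi> i l. if i = l then d $ i else 0)"

text \<open>Note the index order: the sum runs over the off-diagonal entries of the \<open>i\<close>-th column.\<close>

definition c_hat :: "real ^ 'n ^ 'n \<Rightarrow> real ^ 'n" where
  "c_hat C = (\<chi> i. 1 - (\<Sum>j\<in>UNIV - {i}. C $ j $ i))"

definition C_hat :: "real ^ 'n ^ 'n \<Rightarrow> real ^ 'n ^ 'n" where
  "C_hat C = diag_matrix (c_hat C)"

text \<open>An orthant is given by its sign matrix \<open>J\<close>, which plays the role of the orthant index.\<close>

definition sign_matrix :: "real ^ 'n ^ 'n \<Rightarrow> bool" where
  "sign_matrix J \<longleftrightarrow> (\<exists>s. (\<forall>i. s $ i \<in> {-1, 1}) \<and> J = diag_matrix s)"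

definition orthant_matrix :: "real ^ 'n ^ 'n \<Rightarrow> real ^ 'n ^ 'n \<Rightarrow> real ^ 'n ^ 'n" where
  "orthant_matrix C J = J ** C_hat C ** C ** matrix_inv (C_hat C) ** J"

definition lp_feasible ::
  "real ^ 'n ^ 'n \<Rightarrow> real ^ 'n ^ 'n \<Rightarrow> real \<Rightarrow> real ^ 'n ^ 'n \<Rightarrow> bool" where
  "lp_feasible C J \<epsilon> K \<longleftrightarrow>
     (\<forall>i l. - (K $ i $ l) \<le> orthant_matrix C J $ i $ l / c_hat C $ i) \<and>
     (\<forall>i. (\<Sum>l\<in>UNIV. K $ i $ l)
        \<le> 1 / c_hat C $ i * (1 - (\<Sum>l\<in>UNIV. orthant_matrix C J $ i $ l)) - \<epsilon>) \<and>
     (\<forall>i. - (\<Sum>l\<in>UNIV. K $ i $ l)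
        \<le> 1 / c_hat C $ i * (\<Sum>l\<in>UNIV. orthant_matrix C J $ i $ l)) \<and>
     (\<forall>i. K $ i $ i = 0)"

definition lp_objective :: "real ^ 'n ^ 'n \<Rightarrow> real" where
  "lp_objective K = - (\<Sum>i\<in>UNIV. \<Sum>l\<in>UNIV. K $ i $ l)"

definition lp_optimal ::
  "real ^ 'n ^ 'n \<Rightarrow> real ^ 'n ^ 'n \<Rightarrow> real \<Rightarrow> real ^ 'n ^ 'n \<Rightarrow> bool" where
  "lp_optimal C J \<epsilon> K \<longleftrightarrow> is_arg_min lp_objective (lp_feasible C J \<epsilon>) K"

text \<open>Here \<open>K\<close> is the LP variable, not the feedback gain, which is \<open>J ** K\<close>.\<close>

definition closed_loop_matrix ::
  "real ^ 'n ^ 'n \<Rightarrow> real ^ 'n ^ 'n \<Rightarrow> real ^ 'n ^ 'n \<Rightarrow> real ^ 'n ^ 'n" where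
  "closed_loop_matrix C J K = orthant_matrix C J + C_hat C ** K"

end

theory Submission
  imports Defs
begin

text \<open>Left multiplication by the diagonal matrix \<open>C_hat C\<close> scales row
  \<open>i\<close> of \<open>K\<close> by \<open>c_hat C $ i\<close>. As this factor is positive,
  multiplying the LP constraints by it turns them into bounds on the closed-loop matrix: the
  entrywise constraint becomes nonnegativity (\<open>closed_loop_matrix_nonneg\<close>), and the
  upper bound on row sums of \<open>K\<close> keeps full row sums below 1
  (\<open>closed_loop_matrix_row_sum_le\<close>). Nonnegativity then carries this bound over to the
  off-diagonal sums.\<close>

lemma diag_matrix_mult_nth: "(diag_matrix d ** K) $ i $ l = d $ i * K $ i $ l"
  \<comment> \<open>Moving the factor into the \<open>if\<close> leaves a sum with a single
    surviving term.\<close>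
  by (simp add: diag_matrix_def matrix_matrix_mult_def if_distrib[of "\<lambda>x. x * _"] cong: if_cong)

lemma closed_loop_matrix_nth:
  "closed_loop_matrix C J K $ i $ l = orthant_matrix C J $ i $ l + c_hat C $ i * K $ i $ l"
  by (simp add: closed_loop_matrix_def C_hat_def diag_matrix_mult_nth)

lemma closed_loop_matrix_nonneg:
  assumes "c_hat C $ i > 0" and "lp_feasible C J \<epsilon> K"
  shows "closed_loop_matrix C J K $ i $ l \<ge> 0"
proof -
  have "- (K $ i $ l) \<le> orthant_matrix C J $ i $ l / c_hat C $ i"
    using assms(2) by (simp add: lp_feasible_def)
  then show ?thesis
    using assms(1) by (simp add: closed_loop_matrix_nth field_simps)
qed

text \<open>In the constraint \<epsilon> stands outside the factor \<open>1 / c_hat C $ i\<close>,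
  so clearing that factor scales the margin to \<open>c_hat C $ i * \<epsilon>\<close>. For
  \<epsilon> > 0 this margin makes the bound strict.\<close>

lemma closed_loop_matrix_row_sum_le:
  assumes "c_hat C $ i > 0" and "lp_feasible C J \<epsilon> K"
  shows "(\<Sum>l\<in>UNIV. closed_loop_matrix C J K $ i $ l) \<le> 1 - c_hat C $ i * \<epsilon>"
proof -
  have "(\<Sum>l\<in>UNIV. K $ i $ l)
      \<le> 1 / c_hat C $ i * (1 - (\<Sum>l\<in>UNIV. orthant_matrix C J $ i $ l)) - \<epsilon>"
    using assms(2) by (simp add: lp_feasible_def)
  then have "c_hat C $ i * (\<Sum>l\<in>UNIV. K $ i $ l)
      \<le> 1 - (\<Sum>l\<in>UNIV. orthant_matrix C J $ i $ l) - c_hat C $ i * \<epsilon>"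
    using assms(1) by (simp add: field_simps)
  then show ?thesis
    by (simp add: closed_loop_matrix_nth sum.distrib sum_distrib_left)
qed

theorem theorem6:
  fixes C J K :: "real ^ 'n ^ 'n" and \<epsilon> :: real
  assumes "\<forall>i l. C $ i $ l \<in> {0..1}"
    and "\<forall>i. C $ i $ i = 0"
    and "\<forall>i. c_hat C $ i > 0"
    and "sign_matrix J"
    and "\<epsilon> > 0"
    and "lp_optimal C J \<epsilon> K"
  shows "(\<forall>i l. closed_loop_matrix C J K $ i $ l \<ge> 0) \<and>
    (\<forall>i. 0 \<le> (\<Sum>l\<in>UNIV - {i}. closed_loop_matrix C J K $ i $ l) \<and>
         (\<Sum>l\<in>UNIV - {i}. closed_loop_matrix C J K $ i $ l) < 1)"
proof -
  have feasible: "lp_feasible C J \<epsilon> K"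
    using assms(6) by (simp add: lp_optimal_def is_arg_min_def)
  have nonneg: "closed_loop_matrix C J K $ i $ l \<ge> 0" for i l
    using closed_loop_matrix_nonneg[OF _ feasible] assms(3) by blast
  have "(\<Sum>l\<in>UNIV - {i}. closed_loop_matrix C J K $ i $ l) < 1" for i
  proof -
    \<comment> \<open>The omitted diagonal entry is nonnegative, so dropping it cannot raise the
      sum.\<close>
    have "(\<Sum>l\<in>UNIV - {i}. closed_loop_matrix C J K $ i $ l)
        \<le> (\<Sum>l\<in>UNIV. closed_loop_matrix C J K $ i $ l)"
      by (rule sum_mono2) (auto simp: nonneg)
    also have "\<dots> \<le> 1 - c_hat C $ i * \<epsilon>"
      using closed_loop_matrix_row_sum_le[OF _ feasible] assms(3) by blast
    also have "\<dots> < 1"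
      using assms(3,5) by simp
    finally show ?thesis .
  qed
  with nonneg show ?thesis
    by (simp add: sum_nonneg)
qed

end
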